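(* Let $q=p^{e}$ be a prime power ($p$ prime, $e\geq 1$), and let $l$ be an integer with $0\leq l\leq e-1$. Let $n,k$ be positive integers such that one of the following conditions holds: (1) $n\mid (q-1)$ and $1\leq k\leq \left\lfloor\frac{p^{l}+n-1}{p^{l}+1}\right\rfloor$; (2) $n\mid (p^{l}-1)$ and $1\leq k\leq \left\lfloor\frac{n}{2}\right\rfloor$. Then for any integer $h$ with $0\leq h\leq k$, there exists an $[[n,k-h,n-k+1;n-k-h]]_{q}$ MDS EAQECC.
   Context: An $[[N,K,d;c]]_q$ entanglement-assisted quantum error-correcting code (EAQECC) encodes $K$ logical qudits (of dimension $q$) into $N$ channel qudits using $c$ maximally entangled pairs shared in advance by sender and receiver, with minimum distance $d$. Formally: the sender holds $K$ information qudits, $N-K-c$ ancilla qudits in state $|0\rangle$, and her halves of $c$ maximally entangled pairs $q^{-1/2}\sum_{a\in\mathbb{F}_q}|a\rangle|a\rangle$ (the other halves being held by the receiver), and applies a unitary to her $N$ qudits; the code $Q$ is the resulting $q^K$-dimensional subspace of $(\mathbb{C}^q)^{\otimes N}\otimes(\mathbb{C}^q)^{\otimes c}$. Errors act only on the $N$ channel qudits (identity on the receiver's $c$ qudits) and have the form $\mathbf{e}=\gamma^{i}T(\mathbf{a})R(\mathbf{b})$ with $\mathbf{a},\mathbf{b}\in\mathbb{F}_q^N$, where $\gamma$ is a complex primitive $p$-th root of unity, $T(\mathbf{a})|\mathbf{v}\rangle=|\mathbf{v}+\mathbf{a}\rangle$ and $R(\mathbf{b})|\mathbf{v}\rangle=\gamma^{\mathrm{tr}_{\mathbb{F}_q/\mathbb{F}_p}(\sum_i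 b_iv_i)}|\mathbf{v}\rangle$; the weight of $\mathbf{e}$ is $\#\{i:(a_i,b_i)\neq(0,0)\}$. The code has minimum distance $d$ if $d$ is the largest integer such that $\langle \mathbf{u}|\mathbf{e}|\mathbf{v}\rangle=0$ for all $|\mathbf{u}\rangle,|\mathbf{v}\rangle\in Q$ with $\langle\mathbf{u}|\mathbf{v}\rangle=0$ and all errors $\mathbf{e}$ of weight at most $d-1$ (for $K=0$, by the usual convention, the condition is instead that $\langle\mathbf{u}|\mathbf{e}|\mathbf{u}\rangle=0$ for the code state and all errors of weight between $1$ and $d-1$). An $[[N,K,d;c]]_q$ EAQECC is called MDS if $N+c-K=2(d-1)$.
   Formalization: Condition (2) is taken with l ≥ 1: for l = 0 it reads n | 0, true for every n, and the claim fails (p=2, e=1, n=4, k=h=2 would give a [[4,0,3;0]]_2 code, which does not exist). *)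

theory Defs
  imports
    Complex_Main
    "HOL-Library.Cardinality"
    "HOL-Computational_Algebra.Primes"
begin

text \<open>
  The field with \<open>q\<close> elements is a type \<open>'a :: {field, finite}\<close>; \<open>\<F>\<^sub>q\<^sup>m\<close> consists of the lists of
  length \<open>m\<close>.
\<close>

definition words :: "nat \<Rightarrow> 'a list set" where
  "words m = {v. length v = m}"

text \<open>
  A vector of \<open>(\<complex>\<^sup>q)\<^sup>\<otimes>\<^sup>N \<otimes> (\<complex>\<^sup>q)\<^sup>\<otimes>\<^sup>c\<close> is given by its coefficients: \<open>\<psi> v w\<close> is the coefficient of
  \<open>|v\<rangle>|w\<rangle>\<close>, with \<open>v \<in> words N\<close> on the channel side and \<open>w \<in> words c\<close> on the receiver side.
  An operator on the \<open>N\<close> channel qudits is given by its matrix: \<open>A v x\<close> is \<open>\<langle>v|A|x\<rangle>\<close>.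
\<close>

type_synonym 'a state = "'a list \<Rightarrow> 'a list \<Rightarrow> complex"
type_synonym 'a oper = "'a list \<Rightarrow> 'a list \<Rightarrow> complex"

definition inner_prod :: "nat \<Rightarrow> nat \<Rightarrow> 'a::finite state \<Rightarrow> 'a state \<Rightarrow> complex" where
  "inner_prod N c \<phi> \<psi> = (\<Sum>v\<in>words N. \<Sum>w\<in>words c. cnj (\<phi> v w) * \<psi> v w)"

definition oper_mult :: "nat \<Rightarrow> 'a::finite oper \<Rightarrow> 'a oper \<Rightarrow> 'a oper" where
  "oper_mult N A B = (\<lambda>v x. \<Sum>y\<in>words N. A v y * B y x)"

definition adjoint_oper :: "'a oper \<Rightarrow> 'a oper" where
  "adjoint_oper A = (\<lambda>v x. cnj (A x v))"

definition unitary_oper :: "nat \<Rightarrow> 'a::finite oper \<Rightarrow> bool" where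
  "unitary_oper N U \<longleftrightarrow>
     (\<forall>v\<in>words N. \<forall>x\<in>words N.
        oper_mult N U (adjoint_oper U) v x = (if v = x then 1 else 0) \<and>
        oper_mult N (adjoint_oper U) U v x = (if v = x then 1 else 0))"

text \<open>The action of \<open>A \<otimes> I\<close>: the receiver's qudits are untouched.\<close>

definition apply_oper :: "nat \<Rightarrow> 'a::finite oper \<Rightarrow> 'a state \<Rightarrow> 'a state" where
  "apply_oper N A \<psi> = (\<lambda>v w. if v \<in> words N then \<Sum>x\<in>words N. A v x * \<psi> x w else 0)"

definition primitive_root_of_unity :: "nat \<Rightarrow> complex \<Rightarrow> bool" where
  "primitive_root_of_unity m z \<longleftrightarrow> 0 < m \<and> z ^ m = 1 \<and> (\<forall>j. 0 < j \<and> j < m \<longrightarrow> z ^ j \<noteq> 1)"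

text \<open>
  The trace from the field with \<open>p ^ e\<close> elements to its prime field, and the exponent in
  \<open>{0..<p}\<close> representing an element of the prime field.
\<close>

definition abs_trace :: "nat \<Rightarrow> nat \<Rightarrow> 'a::field \<Rightarrow> 'a" where
  "abs_trace p e x = (\<Sum>i<e. x ^ (p ^ i))"

definition residue_rep :: "nat \<Rightarrow> 'a::field \<Rightarrow> nat" where
  "residue_rep p t = (THE j. j < p \<and> of_nat j = t)"

definition shift_oper :: "'a::field list \<Rightarrow> 'a oper" where
  "shift_oper a = (\<lambda>v x. if v = map2 (+) x a then 1 else 0)"

definition phase_oper :: "nat \<Rightarrow> nat \<Rightarrow> complex \<Rightarrow> 'a::field list \<Rightarrow> 'a oper" where
  "phase_oper p e \<gamma> b =
     (\<lambda>v x. if v = x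
       then \<gamma> ^ residue_rep p (abs_trace p e (sum_list (map2 (*) b x))) else 0)"

definition error_oper ::
    "nat \<Rightarrow> nat \<Rightarrow> complex \<Rightarrow> nat \<Rightarrow> nat \<Rightarrow> 'a::{field,finite} list \<Rightarrow> 'a list \<Rightarrow> 'a oper" where
  "error_oper p e \<gamma> N i a b =
     (\<lambda>v x. \<gamma> ^ i * oper_mult N (shift_oper a) (phase_oper p e \<gamma> b) v x)"

definition error_weight :: "nat \<Rightarrow> 'a::zero list \<Rightarrow> 'a list \<Rightarrow> nat" where
  "error_weight N a b = card {i. i < N \<and> (a ! i, b ! i) \<noteq> (0, 0)}"

text \<open>
  The sender's input \<open>|u\<rangle>|0\<dots>0\<rangle>\<close> together with \<open>c\<close> maximally entangled pairs, where
  \<open>|u\<rangle> = \<Sum>x\<in>words K. u x |x\<rangle>\<close>; the product of the pairs is \<open>q\<^sup>-\<^sup>c\<^sup>/\<^sup>2 \<Sum>w\<in>words c. |w\<rangle>|w\<rangle>\<close>.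
\<close>

definition encoder_input ::
    "nat \<Rightarrow> nat \<Rightarrow> nat \<Rightarrow> ('a list \<Rightarrow> complex) \<Rightarrow> 'a::{field,finite} state" where
  "encoder_input N K c u =
     (\<lambda>v w. if w \<in> words c
       then \<Sum>x\<in>words K. if v = x @ replicate (N - K - c) 0 @ w
              then u x * complex_of_real (1 / sqrt (real CARD('a)) ^ c) else 0
       else 0)"

definition ea_code_space ::
    "nat \<Rightarrow> nat \<Rightarrow> nat \<Rightarrow> 'a::{field,finite} oper \<Rightarrow> 'a state set" where
  "ea_code_space N K c U = {apply_oper N U (encoder_input N K c u) | u. True}"

text \<open>
  For \<open>K = 0\<close> the code is a line, so there are no two orthogonal nonzero states; the usual
  convention requires instead that errors of weight between \<open>1\<close> and \<open>d - 1\<close> have expectation zero.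
  This does not depend on the choice of the spanning vector.
\<close>

definition detects_below ::
    "nat \<Rightarrow> nat \<Rightarrow> complex \<Rightarrow> nat \<Rightarrow> nat \<Rightarrow> nat \<Rightarrow> 'a::{field,finite} state set \<Rightarrow> nat \<Rightarrow> bool" where
  "detects_below p e \<gamma> N K c Q d \<longleftrightarrow>
     (if K = 0 then
        \<forall>u\<in>Q. \<forall>i. \<forall>a\<in>words N. \<forall>b\<in>words N.
          1 \<le> error_weight N a b \<and> error_weight N a b < d \<longrightarrow>
          inner_prod N c u (apply_oper N (error_oper p e \<gamma> N i a b) u) = 0
      else
        \<forall>u\<in>Q. \<forall>v\<in>Q. inner_prod N c u v = 0 \<longrightarrow>
          (\<forall>i. \<forall>a\<in>words N. \<forall>b\<in>words N. error_weight N a b < d \<longrightarrow>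
            inner_prod N c u (apply_oper N (error_oper p e \<gamma> N i a b) v) = 0))"

text \<open>
  Every code satisfies the condition for \<open>d = 1\<close>, so that it is harmless to let \<open>d\<close> range over
  the natural numbers only.
\<close>

definition min_distance ::
    "nat \<Rightarrow> nat \<Rightarrow> complex \<Rightarrow> nat \<Rightarrow> nat \<Rightarrow> nat \<Rightarrow> 'a::{field,finite} state set \<Rightarrow> nat \<Rightarrow> bool" where
  "min_distance p e \<gamma> N K c Q d \<longleftrightarrow>
     detects_below p e \<gamma> N K c Q d \<and> (\<forall>d'. detects_below p e \<gamma> N K c Q d' \<longrightarrow> d' \<le> d)"

definition eaqecc ::
    "nat \<Rightarrow> nat \<Rightarrow> complex \<Rightarrow> nat \<Rightarrow> nat \<Rightarrow> nat \<Rightarrow> nat \<Rightarrow> 'a::{field,finite} state set \<Rightarrow> bool" where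
  "eaqecc p e \<gamma> N K d c Q \<longleftrightarrow>
     K + c \<le> N \<and> (\<exists>U. unitary_oper N U \<and> Q = ea_code_space N K c U) \<and>
     min_distance p e \<gamma> N K c Q d"

definition mds_eaqecc ::
    "nat \<Rightarrow> nat \<Rightarrow> complex \<Rightarrow> nat \<Rightarrow> nat \<Rightarrow> nat \<Rightarrow> nat \<Rightarrow> 'a::{field,finite} state set \<Rightarrow> bool" where
  "mds_eaqecc p e \<gamma> N K d c Q \<longleftrightarrow>
     eaqecc p e \<gamma> N K d c Q \<and> int N + int c - int K = 2 * (int d - 1)"

end

theory Submission
  imports Defs "HOL-Number_Theory.Residues" "HOL-Computational_Algebra.Polynomial"
begin

text \<open>
  Both conditions give \<open>n < q\<close> and \<open>2 * k \<le> n\<close>. Fix \<open>n\<close> distinct nonzero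
  points and put \<open>K = k - h\<close>, \<open>c = n - k - h\<close>. The encoder applies a Fourier transform to \<open>h\<close> of the
  \<open>2 * h\<close> ancillas, giving \<open>|x, z, 0, w\<rangle>\<close> summed over all \<open>z\<close> of length \<open>h\<close>, and then replaces this word by
  the values at the points of the polynomial with coefficients \<open>x\<close> at the exponents \<open>0, \<dots>, K - 1\<close>,
  \<open>z\<close> at \<open>K, \<dots>, k - 1\<close>, \<open>w\<close> at \<open>k, \<dots>, n - h - 1\<close> and \<open>0\<close> at \<open>n - h, \<dots>, n - 1\<close>.

  A shift by \<open>a\<close> has nonzero matrix entries only if \<open>a\<close> is the evaluation of a polynomial with
  exponents below \<open>k\<close>; a nonzero such \<open>a\<close> has weight at least \<open>n - k + 1\<close>, and this weight is attained.
  A phase \<open>b\<close> cancels out unless it is orthogonal to the evaluations of all polynomials with exponents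
  in \<open>K, \<dots>, n - h - 1\<close>; these are \<open>n - k\<close> consecutive exponents, so a nonzero such \<open>b\<close> again has weight at
  least \<open>n - k + 1\<close>.
\<close>

subsection \<open>The trace character\<close>

lemma CHAR_of_card_prime_power:
  assumes "prime p" "CARD('a::{field,finite}) = p ^ e"
  shows "CHAR('a) = p"
proof -
  have "prime CHAR('a)"
    using prime_CHAR_semidom[where ?'a='a] finite_imp_CHAR_pos[where ?'a='a] by simp
  moreover have "CHAR('a) dvd p ^ e"
    using CHAR_dvd_CARD[where ?'a='a] assms(2) by simp
  ultimately show ?thesis
    using assms(1) by (metis prime_dvd_power primes_dvd_imp_eq)
qed

text \<open>Multiplication by \<open>x \<noteq> 0\<close> permutes the nonzero elements; cancelling
  their product shows that \<open>x\<close> to the power of their number is 1.\<close>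

lemma power_card_field: "x ^ CARD('a) = (x :: 'a::{field,finite})"
proof (cases "x = 0")
  case True
  then show ?thesis by (simp add: power_0_left)
next
  case False
  let ?P = "\<Prod>y\<in>-{0::'a}. y"
  have "?P = (\<Prod>y\<in>-{0}. x * y)"
    by (rule prod.reindex_bij_witness[of _ "\<lambda>y. x * y" "\<lambda>y. y / x"]) (use False in auto)
  also have "\<dots> = x ^ card (-{0::'a}) * ?P"
    by (simp add: prod.distrib)
  finally have "x ^ card (-{0::'a}) = 1" by simp
  moreover have "CARD('a) = Suc (card (-{0::'a}))"
    by (simp add: Compl_eq_Diff_UNIV card_Suc_Diff1)
  ultimately show ?thesis by simp
qed

locale finite_field_char =
  fixes p e :: nat and \<gamma> :: complex and ty :: "'a::{field,finite} itself"
  assumes prime_p: "prime p" and card_field: "CARD('a) = p ^ e"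
    and root: "primitive_root_of_unity p \<gamma>"
begin

lemma CHAR_eq: "CHAR('a) = p"
  by (rule CHAR_of_card_prime_power[OF prime_p card_field])

lemma e_pos: "e > 0"
proof (rule ccontr)
  assume "\<not> e > 0"
  then have "card (UNIV :: 'a set) = 1" using card_field by simp
  then obtain z where "(UNIV :: 'a set) = {z}" by (auto simp: card_1_singleton_iff)
  then have "(0::'a) = 1" by (metis UNIV_I singletonD)
  then show False by simp
qed

lemma abs_trace_add: "abs_trace p e (x + y :: 'a) = abs_trace p e x + abs_trace p e y"
proof -
  have "(x + y) ^ p ^ i = x ^ p ^ i + y ^ p ^ i" for i
    by (rule freshmans_dream') (use prime_p CHAR_eq in simp_all)
  then show ?thesis by (simp add: abs_trace_def sum.distrib)
qed

text \<open>Raising to the power \<open>p\<close> is additive and shifts the summands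
  \<open>x ^ p ^ i\<close> cyclically, as \<open>x ^ p ^ e = x\<close>. Hence the trace lies in the
  prime field.\<close>

lemma abs_trace_power: "abs_trace p e (x :: 'a) ^ p = abs_trace p e x"
proof -
  have "abs_trace p e x ^ p = (\<Sum>i<e. x ^ p ^ Suc i)"
    unfolding abs_trace_def
    by (subst freshmans_dream_sum[where ?'a='a])
      (use prime_p CHAR_eq in \<open>simp_all add: power_mult[symmetric] mult.commute\<close>)
  \<comment> \<open>The sum over exponents up to \<open>e\<close> is split off at its first and at
    its last term, and these two terms agree.\<close>
  also have "x ^ p ^ 0 + (\<Sum>i<e. x ^ p ^ Suc i) = (\<Sum>i<e. x ^ p ^ i) + x ^ p ^ e"
    using sum.lessThan_Suc[of "\<lambda>i. x ^ p ^ i" e] sum.lessThan_Suc_shift[of "\<lambda>i. x ^ p ^ i" e]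
    by argo
  then have "(\<Sum>i<e. x ^ p ^ Suc i) = (\<Sum>i<e. x ^ p ^ i)"
    using power_card_field[of x] unfolding card_field
    by (simp only: power_0 power_one_right add.commute[of x] add_right_cancel)
  finally show ?thesis unfolding abs_trace_def .
qed

lemma inj_on_of_nat: "inj_on (of_nat :: nat \<Rightarrow> 'a) {..<p}"
  by (auto intro!: inj_onI simp: of_nat_eq_iff_cong_CHAR CHAR_eq cong_def)

text \<open>The images of \<open>0, ..., p - 1\<close> are \<open>p\<close> distinct roots of
  \<open>X ^ p - X\<close>, which has at most \<open>p\<close> roots.\<close>

lemma prime_field_cases:
  assumes "t ^ p = (t :: 'a)"
  obtains j where "j < p" "of_nat j = t"
proof -
  let ?P = "monom 1 p - monom 1 1 :: 'a poly"
  have p1: "p > 1" using prime_p prime_gt_1_nat by blast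
  have "coeff ?P p = 1" using p1 by simp
  then have nz: "?P \<noteq> 0" by (metis coeff_0 zero_neq_one)
  have "degree ?P \<le> p" using p1
    by (intro degree_diff_le) (auto simp: degree_monom_eq)
  then have le: "card {x. poly ?P x = 0} \<le> p"
    using card_poly_roots_bound[OF nz] by linarith
  have "of_nat j ^ p = (of_nat j :: 'a)" for j
  proof (induction j)
    case 0 then show ?case using p1 by simp
  next
    case (Suc j)
    have "(1 + of_nat j :: 'a) ^ p = 1 ^ p + of_nat j ^ p"
      by (rule freshmans_dream) (use prime_p CHAR_eq in simp_all)
    then show ?case using Suc by simp
  qed
  then have sub: "of_nat ` {..<p} \<subseteq> {x. poly ?P x = 0}"
    by (auto simp: poly_monom)
  have "of_nat ` {..<p} = {x. poly ?P x = 0}"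
    using card_image[OF inj_on_of_nat] le poly_roots_finite[OF nz] sub
    by (intro card_seteq) auto
  moreover have "t \<in> {x. poly ?P x = 0}" using assms by (simp add: poly_monom)
  ultimately have "t \<in> of_nat ` {..<p}" by simp
  then show thesis using that by auto
qed

lemma residue_rep_of_nat: "j < p \<Longrightarrow> residue_rep p (of_nat j :: 'a) = j"
  unfolding residue_rep_def using inj_onD[OF inj_on_of_nat] by (intro the_equality) auto

lemma of_nat_residue_rep_trace: "of_nat (residue_rep p (abs_trace p e x)) = abs_trace p e (x::'a)"
proof -
  obtain j where "j < p" "of_nat j = abs_trace p e x"
    using prime_field_cases[OF abs_trace_power] .
  then show ?thesis by (metis residue_rep_of_nat)
qed

definition tr_char :: "'a \<Rightarrow> complex" where
  "tr_char x = \<gamma> ^ residue_rep p (abs_trace p e x)"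

lemma root_power_cong: 
  assumes "[i = j] (mod p)" shows "\<gamma> ^ i = \<gamma> ^ j"
proof -
  have "\<gamma> ^ i = \<gamma> ^ (i mod p)" for i
  proof -
    have "\<gamma> ^ i = \<gamma> ^ (p * (i div p) + i mod p)" by simp
    also have "\<dots> = \<gamma> ^ (i mod p)"
      using root unfolding power_add power_mult primitive_root_of_unity_def by simp
    finally show ?thesis .
  qed
  then show ?thesis using assms unfolding cong_def by metis
qed

text \<open>Residues add only modulo \<open>p\<close>, which is enough because
  \<open>\<gamma> ^ p = 1\<close>.\<close>

lemma tr_char_add: "tr_char (x + y) = tr_char x * tr_char y"
proof -
  have "of_nat (residue_rep p (abs_trace p e (x + y))) =
    (of_nat (residue_rep p (abs_trace p e x) + residue_rep p (abs_trace p e y)) :: 'a)"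
    by (metis of_nat_residue_rep_trace abs_trace_add of_nat_add)
  then have "[residue_rep p (abs_trace p e (x + y)) =
      residue_rep p (abs_trace p e x) + residue_rep p (abs_trace p e y)] (mod p)"
    unfolding of_nat_eq_iff_cong_CHAR CHAR_eq .
  then show ?thesis unfolding tr_char_def by (metis root_power_cong power_add)
qed

lemma tr_char_0 [simp]: "tr_char 0 = 1"
proof -
  have "p > 0" using prime_p prime_gt_0_nat by blast
  then have "abs_trace p e (0::'a) = of_nat 0" by (simp add: abs_trace_def power_0_left)
  then show ?thesis using residue_rep_of_nat[of 0] \<open>p > 0\<close> by (simp add: tr_char_def)
qed

lemma tr_char_nonzero: "tr_char x \<noteq> 0"
  using tr_char_add[of x "-x"] by auto

text \<open>\<open>\<gamma>\<close> lies on the unit circle, so conjugation inverts character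
  values.\<close>

lemma cnj_tr_char: "cnj (tr_char x) = tr_char (- x)"
proof -
  have "norm \<gamma> = 1"
    using root power_eq_1_iff[of \<gamma> p] unfolding primitive_root_of_unity_def by simp
  then have "norm (tr_char x) = 1" by (simp add: tr_char_def norm_power)
  then have "tr_char x * cnj (tr_char x) = 1" by (simp add: complex_norm_square[symmetric])
  moreover have "tr_char x * tr_char (- x) = 1" by (simp flip: tr_char_add)
  ultimately show ?thesis by (metis mult_left_cancel tr_char_nonzero)
qed

text \<open>The trace is a polynomial of degree at most \<open>p ^ (e - 1)\<close>, less than the
  field size, so it is nonzero somewhere; primitivity of \<open>\<gamma>\<close> does the
  rest.\<close>

lemma tr_char_nontrivial: obtains t where "tr_char t \<noteq> 1"
proof -
  have p1: "p > 1" using prime_p prime_gt_1_nat by blast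
  let ?P = "\<Sum>i<e. monom 1 (p ^ i) :: 'a poly"
  \<comment> \<open>Only the summand \<open>i = 0\<close> is linear, so the trace polynomial is not
    zero.\<close>
  have "coeff ?P 1 = (\<Sum>i<e. if i = 0 then 1 else 0)"
    using p1 unfolding coeff_sum by (intro sum.cong) (auto simp: power_eq_1_iff)
  also have "\<dots> = 1" using e_pos by simp
  finally have nz: "?P \<noteq> 0" by force
  have "degree ?P \<le> p ^ (e - 1)"
    using p1 by (intro degree_sum_le) (auto simp: degree_monom_eq intro!: power_increasing)
  then have "card {x. poly ?P x = 0} \<le> p ^ (e - 1)"
    using card_poly_roots_bound[OF nz] by linarith
  also have "\<dots> < CARD('a)" using p1 e_pos card_field by simp
  finally have "{x. poly ?P x = 0} \<noteq> UNIV" by auto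
  then obtain t where "poly ?P t \<noteq> 0" by blast
  then have "abs_trace p e t \<noteq> 0" by (simp add: abs_trace_def poly_sum poly_monom)
  then obtain j where j: "j < p" "of_nat j = abs_trace p e t" "j \<noteq> 0"
    by (metis abs_trace_power prime_field_cases of_nat_0)
  then have "tr_char t = \<gamma> ^ j" unfolding tr_char_def by (metis residue_rep_of_nat)
  then have "tr_char t \<noteq> 1" using root j unfolding primitive_root_of_unity_def by simp
  then show thesis by (rule that)
qed

end

subsection \<open>Words, the partial Fourier transform and errors\<close>

abbreviation vadd :: "'a::plus list \<Rightarrow> 'a list \<Rightarrow> 'a list" where
  "vadd x y \<equiv> map2 (+) x y"

definition dot :: "'a::semiring_0 list \<Rightarrow> 'a list \<Rightarrow> 'a" where
  "dot b x = sum_list (map2 (*) b x)"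

lemma mem_words [simp]: "v \<in> words m \<longleftrightarrow> length v = m"
  by (simp add: words_def)

lemma finite_words [simp]: "finite (words m :: 'a::finite list set)"
  using finite_lists_length_eq[of "UNIV :: 'a set" m] by (simp add: words_def)

lemma card_words: "card (words m :: 'a::finite list set) = CARD('a) ^ m"
  using card_lists_length_eq[of "UNIV :: 'a set" m] by (simp add: words_def)

lemma dot_eq_sum:
  assumes "length b = n" "length x = n"
  shows "dot b x = (\<Sum>i<n. b ! i * x ! i)"
  using assms by (simp add: dot_def sum_list_sum_nth atLeast0LessThan)

lemma dot_vadd:
  fixes b :: "'a::semiring_0 list"
  assumes "length b = n" "length x = n" "length y = n"
  shows "dot b (vadd x y) = dot b x + dot b y"
  using assms by (simp add: dot_eq_sum[of _ n] sum.distrib distrib_left)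

lemma dot_zero_right [simp]: "dot b (replicate n 0) = 0"
proof -
  have "map2 (*) b (replicate n 0) = replicate (min (length b) n) 0"
    by (rule nth_equalityI) auto
  then show ?thesis by (simp add: dot_def sum_list_sum_nth)
qed

lemma dot_zero_left [simp]: "dot (replicate n 0) x = 0"
proof -
  have "map2 (*) (replicate n 0) x = replicate (min n (length x)) 0"
    by (rule nth_equalityI) auto
  then show ?thesis by (simp add: dot_def sum_list_sum_nth)
qed

lemma vadd_zero_right [simp]:
  "length x = n \<Longrightarrow> vadd x (replicate n (0::'a::comm_monoid_add)) = x"
  by (auto intro: nth_equalityI)

lemma vadd_zero_left [simp]:
  "length x = n \<Longrightarrow> vadd (replicate n (0::'a::comm_monoid_add)) x = x"
  by (auto intro: nth_equalityI)

lemma vadd_eq_left_iff: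
  fixes x a :: "'a::ab_group_add list"
  assumes "length x = n" "length a = n"
  shows "vadd x a = x \<longleftrightarrow> a = replicate n 0"
  using assms by (auto simp: list_eq_iff_nth_eq)

lemma vadd_cancel_right:
  fixes x y a :: "'a::ab_group_add list"
  assumes "length x = n" "length y = n" "length a = n"
  shows "vadd x a = vadd y a \<longleftrightarrow> x = y"
  using assms by (auto simp: list_eq_iff_nth_eq)

lemma take_vadd: "take j (vadd x y) = vadd (take j x) (take j y)"
  by (simp add: take_map take_zip)

lemma drop_vadd: "drop j (vadd x y) = vadd (drop j x) (drop j y)"
  by (simp add: drop_map drop_zip)

text \<open>\<open>\<tau>\<close> permutes the finite set \<open>M\<close>, so the sum equals
  \<open>\<kappa>\<close> times itself. This serves both character orthogonality and the
  cancellation of phase errors.\<close>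

lemma sum_eq_0_by_shift:
  fixes f :: "'b \<Rightarrow> complex"
  assumes "finite M" "inj_on \<tau> M" "\<tau> ` M \<subseteq> M" "\<And>x. x \<in> M \<Longrightarrow> f (\<tau> x) = \<kappa> * f x" "\<kappa> \<noteq> 1"
  shows "sum f M = 0"
proof -
  have "\<tau> ` M = M" using assms(1-3) endo_inj_surj by blast
  then have "sum f M = sum (f \<circ> \<tau>) M"
    using sum.reindex[OF assms(2), of f] by simp
  also have "\<dots> = \<kappa> * sum f M"
    using assms(4) by (simp add: sum_distrib_left)
  finally show ?thesis using assms(5) by simp
qed

section \<open>Character orthogonality and unitarity of the partial Fourier transform\<close>

context finite_field_char
begin

lemma sum_tr_char_dot:
  assumes "length m = h" "length m' = h"
  shows "(\<Sum>s\<in>words h. tr_char (dot m s) * cnj (tr_char (dot m' s))) =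
    (if m = m' then of_nat (CARD('a) ^ h) else 0)"
proof (cases "m = m'")
  case True
  have "tr_char x * cnj (tr_char x) = 1" for x
    by (simp add: cnj_tr_char flip: tr_char_add)
  then show ?thesis using True by (simp add: card_words)
next
  case False
  then obtain j where j: "j < h" "m ! j \<noteq> m' ! j"
    using assms by (auto simp: list_eq_iff_nth_eq)
  obtain t where t: "tr_char t \<noteq> 1" using tr_char_nontrivial .
  \<comment> \<open>A single entry at a position where \<open>m\<close> and \<open>m'\<close>
    differ, scaled so that their dot products with \<open>s0\<close> differ by
    \<open>t\<close>.\<close>
  define s0 where "s0 = (replicate h 0)[j := t / (m ! j - m' ! j)]"
  have dot_s0: "dot v s0 = v ! j * (t / (m ! j - m' ! j))" if "length v = h" for v
  proof -
    have "dot v s0 = (\<Sum>i<h. if i = j then v ! j * (t / (m ! j - m' ! j)) else 0)"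
      using that unfolding s0_def
      by (subst dot_eq_sum[of _ h])
        (auto simp: nth_list_update if_distrib cong: if_cong intro!: sum.cong)
    then show ?thesis using j by simp
  qed
  have "dot m s0 - dot m' s0 = t"
    using j assms unfolding dot_s0[OF assms(1)] dot_s0[OF assms(2)] left_diff_distrib[symmetric]
    by simp
  then have k: "tr_char (dot m s0) * cnj (tr_char (dot m' s0)) = tr_char t"
    by (simp add: cnj_tr_char flip: tr_char_add)
  have "(\<Sum>s\<in>words h. tr_char (dot m s) * cnj (tr_char (dot m' s))) = 0"
  proof (rule sum_eq_0_by_shift[where \<tau> = "\<lambda>s. vadd s s0" and \<kappa> = "tr_char t"])
    show "inj_on (\<lambda>s. vadd s s0) (words h)"
      by (auto intro!: inj_onI simp: vadd_cancel_right[of _ h] s0_def)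
    fix s :: "'a list" assume "s \<in> words h"
    then show "tr_char (dot m (vadd s s0)) * cnj (tr_char (dot m' (vadd s s0))) =
        tr_char t * (tr_char (dot m s) * cnj (tr_char (dot m' s)))"
      using assms by (simp add: dot_vadd[of _ h] s0_def tr_char_add flip: k)
  qed (use t in \<open>auto simp: s0_def\<close>)
  then show ?thesis using False by simp
qed

text \<open>The tensor product of the identity on the first \<open>K\<close> positions, the
  normalised Fourier transform on the next \<open>h\<close>, and the identity on the rest.\<close>

definition partial_fourier :: "nat \<Rightarrow> nat \<Rightarrow> 'a oper" where
  "partial_fourier K h m y =
     (if take K m = take K y \<and> drop (K + h) m = drop (K + h) y
      then complex_of_real (1 / sqrt (real CARD('a)) ^ h) *
        tr_char (dot (take h (drop K m)) (take h (drop K y)))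
      else 0)"

lemma partial_fourier_sym:
  "partial_fourier K h m y = partial_fourier K h y m"
proof -
  have "dot x z = dot z x" for x z :: "'a list"
    unfolding dot_def by (rule arg_cong[of _ _ sum_list], rule nth_equalityI) auto
  then show ?thesis unfolding partial_fourier_def by auto
qed

text \<open>Rows that differ outside the transformed block have disjoint supports. Otherwise the sum
  runs over the block alone, where character orthogonality applies and the squared normalisation
  cancels the number of words.\<close>

lemma partial_fourier_orthonormal:
  assumes "K + h \<le> n" "length m = n" "length m' = n"
  shows "(\<Sum>y\<in>words n. partial_fourier K h m y * cnj (partial_fourier K h m' y)) =
    (if m = m' then 1 else 0)"
proof (cases "take K m = take K m' \<and> drop (K + h) m = drop (K + h) m'")
  case False
  then have "partial_fourier K h m y * cnj (partial_fourier K h m' y) = 0" for y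
    by (auto simp: partial_fourier_def)
  then show ?thesis using False by (auto intro!: sum.neutral)
next
  case True
  define x r where "x = take K m" and "r = drop (K + h) m"
  have len: "length x = K" "length r = n - (K + h)" using assms by (auto simp: x_def r_def)
  have split: "v = take K v @ take h (drop K v) @ drop (K + h) v" for v :: "'a list"
    by (metis append_take_drop_id drop_drop add.commute)
  let ?c = "complex_of_real (1 / sqrt (real CARD('a)) ^ h)"
  let ?d = "take h (drop K m)" and ?d' = "take h (drop K m')"
  have eq: "m = m' \<longleftrightarrow> ?d = ?d'" using split[of m] split[of m'] True by metis
  have "(\<Sum>y\<in>words n. partial_fourier K h m y * cnj (partial_fourier K h m' y)) =
    (\<Sum>y\<in>(\<lambda>s. x @ s @ r) ` words h. partial_fourier K h m y * cnj (partial_fourier K h m' y))"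
  proof (rule sum.mono_neutral_right)
    show "(\<lambda>s. x @ s @ r) ` words h \<subseteq> words n"
      using assms len by auto
    show "\<forall>y\<in>words n - (\<lambda>s. x @ s @ r) ` words h.
        partial_fourier K h m y * cnj (partial_fourier K h m' y) = 0"
    proof
      fix y :: "'a list" assume y: "y \<in> words n - (\<lambda>s. x @ s @ r) ` words h"
      have "\<not> (x = take K y \<and> r = drop (K + h) y)"
      proof
        assume "x = take K y \<and> r = drop (K + h) y"
        then have "y = x @ take h (drop K y) @ r" using split[of y] by simp
        moreover have "take h (drop K y) \<in> words h" using y assms by simp
        ultimately show False using y by blast
      qed
      then show "partial_fourier K h m y * cnj (partial_fourier K h m' y) = 0"
        by (auto simp: partial_fourier_def x_def r_def)
    qed
  qed simp
  also have "\<dots> = (\<Sum>s\<in>words h. partial_fourier K h m (x @ s @ r) *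
      cnj (partial_fourier K h m' (x @ s @ r)))"
    by (subst sum.reindex) (auto intro: inj_onI)
  also have "\<dots> = (\<Sum>s\<in>words h. ?c ^ 2 * (tr_char (dot ?d s) * cnj (tr_char (dot ?d' s))))"
    using len True
    by (intro sum.cong) (auto simp: partial_fourier_def x_def r_def power2_eq_square)
  also have "\<dots> = ?c ^ 2 * (if ?d = ?d' then of_nat (CARD('a) ^ h) else 0)"
    using assms by (subst sum_tr_char_dot[symmetric]) (auto simp: sum_distrib_left)
  also have "?c ^ 2 * of_nat (CARD('a) ^ h) = 1"
  proof -
    have "(1 / sqrt (real CARD('a)) ^ h) ^ 2 * real CARD('a) ^ h = 1"
      by (simp add: power_divide flip: power_mult power_mult_distrib)
         (simp add: mult.commute[of h] power_mult)
    then show ?thesis by (metis of_real_1 of_real_mult of_real_of_nat_eq of_real_power of_nat_power)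
  qed
  then have "?c ^ 2 * (if ?d = ?d' then of_nat (CARD('a) ^ h) else 0) = (if m = m' then 1 else 0)"
    using eq by simp
  finally show ?thesis .
qed

text \<open>The bijection only permutes rows. Orthonormality of the columns follows from that of the
  rows because the Fourier matrix is symmetric.\<close>

lemma unitary_partial_fourier_permuted:
  assumes "K + h \<le> n" "bij_betw g (words n) (words n)"
  shows "unitary_oper n (\<lambda>v y. partial_fourier K h (g v) y)"
proof -
  let ?F = "partial_fourier K h"
  have g: "length (g v) = n" if "length v = n" for v
    using assms(2) that by (metis bij_betw_apply mem_words)
  have inj: "g v = g x \<longleftrightarrow> v = x" if "length v = n" "length x = n" for v x
    using assms(2) that by (metis bij_betw_imp_inj_on inj_onD mem_words)
  have "(\<Sum>y\<in>words n. cnj (?F (g y) v) * ?F (g y) x) = (if v = x then 1 else 0)"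
    if "length v = n" "length x = n" for v x
  proof -
    have "(\<Sum>y\<in>words n. cnj (?F (g y) v) * ?F (g y) x) = (\<Sum>y\<in>words n. cnj (?F y v) * ?F y x)"
      by (rule sum.reindex_bij_betw[OF assms(2)])
    also have "\<dots> = (\<Sum>y\<in>words n. ?F x y * cnj (?F v y))"
      by (simp add: partial_fourier_sym[of _ _ _ x] partial_fourier_sym[of _ _ _ v] mult.commute)
    finally show ?thesis using partial_fourier_orthonormal[OF assms(1)] that by auto
  qed
  then show ?thesis
    using partial_fourier_orthonormal[OF assms(1)] g inj
    by (simp add: unitary_oper_def oper_mult_def adjoint_oper_def)
qed

section \<open>Matrix elements of error operators\<close>

lemma apply_error_oper:
  assumes "length a = n" "length b = n"
  shows "apply_oper n (error_oper p e \<gamma> n i a b) \<psi> =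
    (\<lambda>v w. if length v = n
       then \<Sum>x\<in>words n. if v = vadd x a then \<gamma> ^ i * tr_char (dot b x) * \<psi> x w else 0 else 0)"
proof -
  have "error_oper p e \<gamma> n i a b v x =
      (if v = vadd x a then \<gamma> ^ i * tr_char (dot b x) else 0)" if "length x = n" for v x
  proof -
    have "oper_mult n (shift_oper a) (phase_oper p e \<gamma> b) v x =
      (\<Sum>y\<in>words n. if y = x then (if v = vadd x a then tr_char (dot b x) else 0) else 0)"
      unfolding oper_mult_def
      by (intro sum.cong) (auto simp: shift_oper_def phase_oper_def tr_char_def dot_def)
    then show ?thesis using that by (simp add: error_oper_def)
  qed
  then show ?thesis
    by (auto simp: apply_oper_def fun_eq_iff intro!: sum.cong)
qed

lemma inner_prod_error_oper:
  assumes "length a = n" "length b = n"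
  shows "inner_prod n c \<phi> (apply_oper n (error_oper p e \<gamma> n i a b) \<psi>) =
    \<gamma> ^ i * (\<Sum>x\<in>words n. \<Sum>w\<in>words c. tr_char (dot b x) * cnj (\<phi> (vadd x a) w) * \<psi> x w)"
proof -
  have "inner_prod n c \<phi> (apply_oper n (error_oper p e \<gamma> n i a b) \<psi>) =
    (\<Sum>v\<in>words n. \<Sum>w\<in>words c. \<Sum>x\<in>words n.
      if v = vadd x a then \<gamma> ^ i * tr_char (dot b x) * cnj (\<phi> (vadd x a) w) * \<psi> x w else 0)"
    unfolding inner_prod_def apply_error_oper[OF assms]
    by (intro sum.cong) (auto simp: sum_distrib_left intro!: sum.cong)
  \<comment> \<open>The row \<open>v\<close> is determined by \<open>x\<close>, so the sum over
    \<open>v\<close> is moved innermost, where it collapses.\<close>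
  also have "\<dots> = (\<Sum>w\<in>words c. \<Sum>x\<in>words n. \<Sum>v\<in>words n.
      if v = vadd x a then \<gamma> ^ i * tr_char (dot b x) * cnj (\<phi> (vadd x a) w) * \<psi> x w else 0)"
    by (rule trans[OF sum.swap]) (intro sum.cong refl sum.swap)
  also have "\<dots> = (\<Sum>w\<in>words c. \<Sum>x\<in>words n.
      \<gamma> ^ i * tr_char (dot b x) * cnj (\<phi> (vadd x a) w) * \<psi> x w)"
    using assms by (intro sum.cong refl) simp
  also have "\<dots> = (\<Sum>x\<in>words n. \<Sum>w\<in>words c.
      \<gamma> ^ i * tr_char (dot b x) * cnj (\<phi> (vadd x a) w) * \<psi> x w)"
    by (rule sum.swap)
  finally show ?thesis by (simp add: sum_distrib_left mult.assoc)
qed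

end

subsection \<open>Codes from a linear encoding\<close>

text \<open>A CSS-type construction. \<open>G\<close> relabels basis words, whose blocks of lengths
  \<open>K\<close>, \<open>h\<close>, \<open>h\<close>, \<open>c\<close> hold the information, the
  superposed ancillas, the ancillas left at zero and the sender's halves of the pairs.\<close>

locale css_encoding = finite_field_char p e \<gamma> ty
  for p e :: nat and \<gamma> :: complex and ty :: "'a::{field,finite} itself" +
  fixes G :: "'a list \<Rightarrow> 'a list" and n k K h c :: nat
  assumes k_eq: "k = K + h" and n_eq: "n = k + h + c"
    and bij_G: "bij_betw G (words n) (words n)"
    and G_vadd: "\<And>x y. length x = n \<Longrightarrow> length y = n \<Longrightarrow> G (vadd x y) = vadd (G x) (G y)"
begin

definition G_inv :: "'a list \<Rightarrow> 'a list" where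
  "G_inv = inv_into (words n) G"

lemma length_G: "length x = n \<Longrightarrow> length (G x) = n"
  using bij_betw_apply[OF bij_G, of x] by simp

lemma bij_G_inv: "bij_betw G_inv (words n) (words n)"
  unfolding G_inv_def by (rule bij_betw_inv_into[OF bij_G])

lemma length_G_inv: "length x = n \<Longrightarrow> length (G_inv x) = n"
  using bij_betw_apply[OF bij_G_inv, of x] by simp

lemma G_G_inv: "length x = n \<Longrightarrow> G (G_inv x) = x"
  unfolding G_inv_def using bij_betw_inv_into_right[OF bij_G] by simp

lemma G_inv_G: "length x = n \<Longrightarrow> G_inv (G x) = x"
  unfolding G_inv_def using bij_betw_inv_into_left[OF bij_G] by simp

lemma G_inv_vadd:
  assumes "length x = n" "length y = n"
  shows "G_inv (vadd x y) = vadd (G_inv x) (G_inv y)"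
proof -
  have "vadd x y = G (vadd (G_inv x) (G_inv y))"
    using assms by (simp add: G_vadd length_G_inv G_G_inv)
  then show ?thesis using assms by (simp add: G_inv_G length_G_inv)
qed

lemma G_zero: "G (replicate n 0) = replicate n 0"
proof -
  have "G (replicate n 0) = vadd (G (replicate n 0)) (G (replicate n 0))"
    using G_vadd[of "replicate n 0" "replicate n 0"] by simp
  then show ?thesis using vadd_eq_left_iff[of "G (replicate n 0)" n "G (replicate n 0)"]
    by (simp add: length_G)
qed

lemma G_inv_zero: "G_inv (replicate n 0) = replicate n 0"
  using G_inv_G[of "replicate n 0"] G_zero by simp

text \<open>The Fourier transform followed by the relabelling of \<open>y\<close> as
  \<open>G y\<close>; on matrices this makes row \<open>v\<close> the Fourier row of
  \<open>G_inv v\<close>.\<close>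

definition encoder :: "'a oper" where
  "encoder v y = partial_fourier K h (G_inv v) y"

definition encode :: "('a list \<Rightarrow> complex) \<Rightarrow> 'a state" where
  "encode u = apply_oper n encoder (encoder_input n K c u)"

text \<open>The exponent is \<open>n - k = h + c\<close>: one factor for each transformed ancilla
  and one for each entangled pair.\<close>

definition amplitude :: complex where
  "amplitude = complex_of_real (1 / sqrt (real CARD('a)) ^ (n - k))"

text \<open>
  On the encoded states the positions \<open>k, \<dots>, k + h - 1\<close> carry the ancillas left in state \<open>|0\<rangle>\<close>, while
  the remaining \<open>n - k - h\<close> positions from \<open>k + h\<close> on repeat the receiver's word.
\<close>

definition free_words :: "'a list set" where
  "free_words = {m \<in> words n. take h (drop k m) = replicate h 0}"

lemma finite_free_words [simp]: "finite free_words"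
  by (rule finite_subset[of _ "words n"]) (auto simp: free_words_def)

lemma amplitude_nonzero: "amplitude \<noteq> 0"
  by (simp add: amplitude_def)

lemma cnj_amplitude: "cnj amplitude = amplitude"
  by (simp add: amplitude_def)

lemma unitary_encoder: "unitary_oper n encoder"
proof -
  have "unitary_oper n (\<lambda>v y. partial_fourier K h (G_inv v) y)"
    using k_eq n_eq bij_G_inv by (intro unitary_partial_fourier_permuted) auto
  then show ?thesis by (simp add: encoder_def[abs_def])
qed

lemma code_space_encoder: "ea_code_space n K c encoder = range encode"
  by (auto simp: ea_code_space_def encode_def)

text \<open>The transformed block of the input is zero, so all character values are 1 and the block
  becomes a uniform superposition.\<close>

lemma partial_fourier_encoder_input:
  assumes "length x = K" "length w = c" "length m = n"
  shows "partial_fourier K h m (x @ replicate (2 * h) 0 @ w) =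
    (if take K m = x \<and> drop k m = replicate h 0 @ w
     then complex_of_real (1 / sqrt (real CARD('a)) ^ h) else 0)"
proof -
  have "replicate (2 * h) (0::'a) = replicate h 0 @ replicate h 0"
    by (simp add: mult_2 replicate_add)
  then show ?thesis
    using assms k_eq by (simp add: partial_fourier_def)
qed

text \<open>For each \<open>x\<close> and \<open>w\<close> the input has a single channel word, so
  both sums collapse; \<open>G_inv v\<close> then recovers the blocks.\<close>

lemma encode_eq:
  assumes "length v = n" "length w = c"
  shows "encode u v w =
    (if drop k (G_inv v) = replicate h 0 @ w then amplitude * u (take K (G_inv v)) else 0)"
proof -
  let ?F = "partial_fourier K h"
  let ?s = "complex_of_real (1 / sqrt (real CARD('a)) ^ c)"
  let ?y = "\<lambda>x. x @ replicate (2 * h) 0 @ w"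
  have nKc: "n - K - c = 2 * h" using k_eq n_eq by simp
  have "encode u v w = (\<Sum>y\<in>words n. \<Sum>x\<in>words K. if y = ?y x then ?F (G_inv v) y * (u x * ?s) else 0)"
    unfolding encode_def apply_oper_def encoder_input_def encoder_def nKc
    using assms by (auto simp: sum_distrib_left intro!: sum.cong)
  also have "\<dots> = (\<Sum>x\<in>words K. \<Sum>y\<in>words n. if y = ?y x then ?F (G_inv v) y * (u x * ?s) else 0)"
    by (rule sum.swap)
  also have "\<dots> = (\<Sum>x\<in>words K. ?F (G_inv v) (?y x) * (u x * ?s))"
    using assms k_eq n_eq by (intro sum.cong refl) simp
  also have "\<dots> = (\<Sum>x\<in>words K. if x = take K (G_inv v)
      then (if drop k (G_inv v) = replicate h 0 @ w then amplitude * u x else 0) else 0)"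
  proof (intro sum.cong refl)
    have amp: "amplitude = ?s * complex_of_real (1 / sqrt (real CARD('a)) ^ h)"
      using k_eq n_eq unfolding amplitude_def
      by (simp add: add.commute[of h] flip: power_add)
    show "?F (G_inv v) (?y x) * (u x * ?s) = (if x = take K (G_inv v)
      then (if drop k (G_inv v) = replicate h 0 @ w then amplitude * u x else 0) else 0)"
      if "x \<in> words K" for x
    proof -
      have F: "?F (G_inv v) (?y x) = (if take K (G_inv v) = x \<and> drop k (G_inv v) = replicate h 0 @ w
          then complex_of_real (1 / sqrt (real CARD('a)) ^ h) else 0)"
        using that assms by (intro partial_fourier_encoder_input) (auto simp: length_G_inv)
      show ?thesis unfolding amp F by simp
    qed
  qed
  also have "\<dots> = (if drop k (G_inv v) = replicate h 0 @ w then amplitude * u (take K (G_inv v)) else 0)"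
  proof -
    have "length (take K (G_inv v)) = K"
      unfolding length_take length_G_inv[OF assms(1)] using k_eq n_eq by simp
    then show ?thesis by simp
  qed
  finally show ?thesis .
qed

text \<open>In the coordinates \<open>x = G m\<close> the shift becomes addition of
  \<open>G_inv a\<close>. The receiver's word and the zero ancillas agree in both states, so a term
  survives only if \<open>G_inv a\<close> vanishes from position \<open>k\<close> on.\<close>

lemma inner_prod_encode_error:
  assumes "length a = n" "length b = n"
  shows "inner_prod n c (encode u) (apply_oper n (error_oper p e \<gamma> n i a b) (encode u')) =
    (if drop k (G_inv a) = replicate (n - k) 0
     then \<gamma> ^ i * amplitude ^ 2 * (\<Sum>m\<in>free_words. tr_char (dot b (G m)) *
       cnj (u (take K (vadd m (G_inv a)))) * u' (take K m))
     else 0)"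
proof -
  let ?f = "\<lambda>x w. tr_char (dot b x) * cnj (encode u (vadd x a) w) * encode u' x w"
  let ?h = "\<lambda>m. if drop k (G_inv a) = replicate (n - k) 0
     then amplitude ^ 2 * (tr_char (dot b (G m)) *
       cnj (u (take K (vadd m (G_inv a)))) * u' (take K m)) else 0"
  have inner: "(\<Sum>w\<in>words c. ?f (G m) w) = (if m \<in> free_words then ?h m else 0)"
    if m: "length m = n" for m
  proof -
    have *: "?f (G m) w = (if w = drop (k + h) m then if m \<in> free_words then ?h m else 0 else 0)"
      if w: "w \<in> words c" for w
    proof (cases "drop k m = replicate h 0 @ w")
      case True
      have "drop (k + h) m = drop h (drop k m)" by (simp add: add.commute)
      then have wm: "w = drop (k + h) m" "m \<in> free_words" using True m by (auto simp: free_words_def)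
      have "drop k (vadd m (G_inv a)) = replicate h 0 @ w \<longleftrightarrow> drop k (G_inv a) = replicate (n - k) 0"
        unfolding drop_vadd True[symmetric]
        by (rule vadd_eq_left_iff) (use m assms in \<open>simp_all add: length_G_inv\<close>)
      then show ?thesis
        using wm True m assms w
        by (simp add: encode_eq length_G G_inv_G G_inv_vadd cnj_amplitude power2_eq_square)
    next
      case False
      then have "encode u' (G m) w = 0"
        using m w by (simp add: encode_eq length_G G_inv_G)
      moreover have "\<not> (w = drop (k + h) m \<and> m \<in> free_words)"
      proof
        assume "w = drop (k + h) m \<and> m \<in> free_words"
        moreover have "drop k m = take h (drop k m) @ drop (k + h) m"
          by (metis append_take_drop_id drop_drop add.commute)
        ultimately show False using False by (simp add: free_words_def)
      qed
      ultimately show ?thesis by auto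
    qed
    have "drop (k + h) m \<in> words c" using m n_eq by simp
    then show ?thesis using * by simp
  qed
  have "(\<Sum>x\<in>words n. \<Sum>w\<in>words c. ?f x w) = (\<Sum>m\<in>words n. \<Sum>w\<in>words c. ?f (G m) w)"
    by (rule sum.reindex_bij_betw[OF bij_G, symmetric])
  also have "\<dots> = (\<Sum>m\<in>words n. if m \<in> free_words then ?h m else 0)"
    using inner by (intro sum.cong) auto
  also have "\<dots> = (\<Sum>m\<in>free_words. ?h m)"
    by (rule sum.mono_neutral_cong_right) (auto simp: free_words_def)
  finally show ?thesis
    unfolding inner_prod_error_oper[OF assms] by (simp add: sum_distrib_left mult.assoc)
qed

section \<open>Error detection and the minimum distance\<close>

lemma inner_prod_identity_error:
  "inner_prod n c \<phi> (apply_oper n (error_oper p e \<gamma> n i (replicate n (0::'a)) (replicate n 0)) \<psi>) =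
    \<gamma> ^ i * inner_prod n c \<phi> \<psi>"
  by (subst inner_prod_error_oper) (simp_all add: inner_prod_def)

lemma error_weight_eq_0_iff:
  assumes "length a = n" "length b = n"
  shows "error_weight n a b = 0 \<longleftrightarrow> a = replicate n 0 \<and> b = replicate n (0::'a)"
  using assms by (auto simp: error_weight_def list_eq_iff_nth_eq)

lemma card_nonzero_le_error_weight:
  "card {i. i < n \<and> a ! i \<noteq> 0} \<le> error_weight n a (b :: 'a list)"
  "card {i. i < n \<and> b ! i \<noteq> 0} \<le> error_weight n (a :: 'a list) b"
  unfolding error_weight_def by (rule card_mono; auto)+

text \<open>By \<open>X\<close>, a shift of low weight that maps code words to code words is
  trivial. By \<open>Z\<close>, a nonzero phase of low weight varies over the free words with fixed
  information part, so its terms cancel. The word \<open>m1\<close> gives an undetected shift of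
  weight \<open>n - k + 1\<close>.\<close>

lemma min_distance_css:
  assumes k_pos: "k > 0"
    and X: "\<And>m. length m = n \<Longrightarrow> drop k m = replicate (n - k) 0 \<Longrightarrow>
      card {i. i < n \<and> G m ! i \<noteq> 0} \<le> n - k \<Longrightarrow> m = replicate n 0"
    and Z: "\<And>b t. length b = n \<Longrightarrow> b \<noteq> replicate n 0 \<Longrightarrow> card {i. i < n \<and> b ! i \<noteq> 0} \<le> n - k \<Longrightarrow>
      \<exists>m. length m = n \<and> take K m = replicate K 0 \<and>
        take h (drop k m) = replicate h 0 \<and> dot b (G m) = t"
    and m1: "length m1 = n" "drop k m1 = replicate (n - k) 0"
      "card {i. i < n \<and> G m1 ! i \<noteq> 0} = n - k + 1"
      "K > 0 \<Longrightarrow> take K m1 \<noteq> replicate K 0"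
  shows "min_distance p e \<gamma> n K c (range encode) (n - k + 1)"
  unfolding min_distance_def
proof (intro conjI allI impI)
  let ?Q = "range encode"
  have detect: "inner_prod n c (encode u) (apply_oper n (error_oper p e \<gamma> n i a b) (encode u')) = 0"
    if asm: "length a = n" "length b = n" "1 \<le> error_weight n a b" "error_weight n a b < n - k + 1"
    for u u' i a b
  proof (cases "drop k (G_inv a) = replicate (n - k) 0")
    case False
    then show ?thesis using that by (simp add: inner_prod_encode_error)
  next
    case True
    have "card {i. i < n \<and> G (G_inv a) ! i \<noteq> 0} \<le> n - k"
      using that card_nonzero_le_error_weight(1)[of a b] by (simp add: G_G_inv)
    then have ga: "G_inv a = replicate n 0" using X[OF _ True] that length_G_inv by blast
    then have "a = replicate n 0" using G_G_inv[OF that(1)] G_zero by simp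
    then have "b \<noteq> replicate n 0" using that error_weight_eq_0_iff[of a b] by auto
    obtain t where t: "tr_char t \<noteq> 1" using tr_char_nontrivial .
    \<comment> \<open>Adding \<open>m0\<close> permutes the free words and keeps their information
      part, but multiplies each term by \<open>tr_char t\<close>.\<close>
    obtain m0 where m0: "length m0 = n" "take K m0 = replicate K 0"
        "take h (drop k m0) = replicate h 0" "dot b (G m0) = t"
      using Z[of b t] asm \<open>b \<noteq> replicate n 0\<close> card_nonzero_le_error_weight(2)[of b a] by auto
    have "(\<Sum>m\<in>free_words. tr_char (dot b (G m)) * cnj (u (take K m)) * u' (take K m)) = 0"
    proof (rule sum_eq_0_by_shift[where \<tau> = "\<lambda>m. vadd m m0" and \<kappa> = "tr_char t"])
      show "inj_on (\<lambda>m. vadd m m0) free_words"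
        using m0 by (auto intro!: inj_onI simp: vadd_cancel_right[of _ n] free_words_def)
      show "(\<lambda>m. vadd m m0) ` free_words \<subseteq> free_words"
        using m0 by (auto simp: free_words_def take_vadd drop_vadd)
      fix m assume "m \<in> free_words"
      then have "length m = n" by (simp add: free_words_def)
      moreover from this have "take K (vadd m m0) = take K m"
        using m0 k_eq n_eq by (simp add: take_vadd)
      ultimately show "tr_char (dot b (G (vadd m m0))) * cnj (u (take K (vadd m m0))) *
          u' (take K (vadd m m0)) =
          tr_char t * (tr_char (dot b (G m)) * cnj (u (take K m)) * u' (take K m))"
        using m0 asm by (simp add: G_vadd dot_vadd[of _ n] length_G tr_char_add)
    qed (use t in auto)
    moreover have "(\<Sum>m\<in>free_words. tr_char (dot b (G m)) *
       cnj (u (take K (vadd m (G_inv a)))) * u' (take K m)) =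
       (\<Sum>m\<in>free_words. tr_char (dot b (G m)) * cnj (u (take K m)) * u' (take K m))"
      by (intro sum.cong) (auto simp: free_words_def ga)
    ultimately show ?thesis using asm by (simp add: inner_prod_encode_error)
  qed
  show "detects_below p e \<gamma> n K c ?Q (n - k + 1)"
  proof (cases "K = 0")
    case True
    then show ?thesis using detect by (auto simp: detects_below_def)
  next
    case False
    have "inner_prod n c \<phi> (apply_oper n (error_oper p e \<gamma> n i a b) \<psi>) = 0"
      if "\<phi> \<in> ?Q" "\<psi> \<in> ?Q" "inner_prod n c \<phi> \<psi> = 0"
        "length a = n" "length b = n" "error_weight n a b < n - k + 1" for \<phi> \<psi> i a b
    \<comment> \<open>An error of weight zero is a scalar and keeps orthogonal states orthogonal;
      all others fall under \<open>detect\<close>.\<close>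
    proof (cases "error_weight n a b = 0")
      case True
      then show ?thesis using that error_weight_eq_0_iff[of a b] inner_prod_identity_error by simp
    next
      case False
      then show ?thesis using that detect by auto
    qed
    then show ?thesis using False by (auto simp: detects_below_def)
  qed
  fix d' assume d': "detects_below p e \<gamma> n K c ?Q d'"
  show "d' \<le> n - k + 1"
  proof (rule ccontr)
    assume "\<not> d' \<le> n - k + 1"
    \<comment> \<open>The shift by \<open>G m1\<close> carries the words of \<open>\<psi>\<close> to
      words of \<open>\<phi>\<close> without phases, so no terms cancel and the matrix element is a
      multiple of a count.\<close>
    define \<phi> \<psi> where "\<phi> = encode (\<lambda>x. if x = take K m1 then 1 else 0)"
      and "\<psi> = encode (\<lambda>x. if x = replicate K 0 then 1 else 0)"
    let ?E = "error_oper p e \<gamma> n 0 (G m1) (replicate n 0)"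
    have wt: "error_weight n (G m1) (replicate n 0) = n - k + 1"
      unfolding error_weight_def m1(3)[symmetric] by (rule arg_cong[of _ _ card]) auto
    have "inner_prod n c \<phi> (apply_oper n ?E \<psi>) = amplitude ^ 2 *
      (\<Sum>m\<in>free_words. if take K m = replicate K 0 then 1 else 0)"
    proof -
      have "take K (vadd m m1) = take K m1"
        if "m \<in> free_words" "take K m = replicate K 0" for m
        using that m1 k_eq n_eq by (simp add: take_vadd free_words_def)
      then have "(\<Sum>m\<in>free_words. cnj (if take K (vadd m m1) = take K m1 then 1 else 0) *
          (if take K m = replicate K 0 then 1 else 0)) =
        (\<Sum>m\<in>free_words. if take K m = replicate K 0 then 1 else 0 :: complex)"
        by (intro sum.cong) auto
      then show ?thesis
        unfolding \<phi>_def \<psi>_def using m1 by (simp add: inner_prod_encode_error length_G G_inv_G)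
    qed
    also have "(\<Sum>m\<in>free_words. if take K m = replicate K 0 then 1 else 0) =
        (of_nat (card {m \<in> free_words. take K m = replicate K 0}) :: complex)"
      by (simp add: sum.If_cases Int_def)
    finally have *: "inner_prod n c \<phi> (apply_oper n ?E \<psi>) = amplitude ^ 2 *
        of_nat (card {m \<in> free_words. take K m = replicate K 0})" .
    have "replicate n 0 \<in> {m \<in> free_words. take K m = replicate K 0}"
      unfolding free_words_def using k_eq n_eq by simp
    then have "card {m \<in> free_words. take K m = replicate K 0} \<noteq> 0"
      by (subst card_0_eq) auto
    then have nz: "inner_prod n c \<phi> (apply_oper n ?E \<psi>) \<noteq> 0"
      using * amplitude_nonzero by simp
    have mem: "\<phi> \<in> ?Q" "\<psi> \<in> ?Q" by (auto simp: \<phi>_def \<psi>_def)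
    show False
    proof (cases "K = 0")
      case True
      \<comment> \<open>The empty word is the only information word, so the convention for
        expectation values applies.\<close>
      then have eq: "\<phi> = \<psi>" by (simp add: \<phi>_def \<psi>_def)
      have "\<forall>i. \<forall>a\<in>words n. \<forall>b\<in>words n. 1 \<le> error_weight n a b \<and> error_weight n a b < d' \<longrightarrow>
          inner_prod n c \<psi> (apply_oper n (error_oper p e \<gamma> n i a b) \<psi>) = 0"
        using d' mem(2) unfolding detects_below_def if_P[OF True] by (rule bspec)
      then have "inner_prod n c \<phi> (apply_oper n ?E \<psi>) = 0"
        using wt eq \<open>\<not> d' \<le> n - k + 1\<close> length_G[OF m1(1)] by simp
      then show False using nz by simp
    next
      case False
      \<comment> \<open>Writing the overlap with the trivial error lets the same formula apply; its
        terms vanish because the information parts differ by \<open>m1(4)\<close>.\<close>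
      have "inner_prod n c \<phi> \<psi> = inner_prod n c \<phi>
          (apply_oper n (error_oper p e \<gamma> n 0 (replicate n 0) (replicate n 0)) \<psi>)"
        by (simp add: inner_prod_identity_error)
      also have "\<dots> = amplitude ^ 2 * (\<Sum>m\<in>free_words. tr_char (dot (replicate n 0) (G m)) *
          cnj (if take K (vadd m (G_inv (replicate n 0))) = take K m1 then 1 else 0) *
          (if take K m = replicate K 0 then 1 else 0))"
        unfolding \<phi>_def \<psi>_def by (subst inner_prod_encode_error) (simp_all add: G_inv_zero)
      also have "(\<Sum>m\<in>free_words. tr_char (dot (replicate n 0) (G m)) *
          cnj (if take K (vadd m (G_inv (replicate n 0))) = take K m1 then 1 else 0) *
          (if take K m = replicate K 0 then 1 else 0)) = 0"
        by (rule sum.neutral) (use m1(4) False in \<open>auto simp: free_words_def G_inv_zero\<close>)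
      finally have "inner_prod n c \<phi> \<psi> = 0" by simp
      moreover have "inner_prod n c \<phi> \<psi> = 0 \<longrightarrow> (\<forall>i. \<forall>a\<in>words n. \<forall>b\<in>words n.
          error_weight n a b < d' \<longrightarrow>
          inner_prod n c \<phi> (apply_oper n (error_oper p e \<gamma> n i a b) \<psi>) = 0)"
        by (rule bspec[OF bspec[OF d'[unfolded detects_below_def if_not_P[OF False]] mem(1)] mem(2)])
      ultimately have "inner_prod n c \<phi> (apply_oper n ?E \<psi>) = 0"
        using wt \<open>\<not> d' \<le> n - k + 1\<close> length_G[OF m1(1)] by simp
      then show False using nz by simp
    qed
  qed
qed

end

subsection \<open>The encoding by polynomial evaluation\<close>

definition evaluate :: "'a::comm_semiring_1 list \<Rightarrow> 'a poly \<Rightarrow> 'a list" where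
  "evaluate pts f = map (poly f) pts"

lemma length_evaluate [simp]: "length (evaluate pts f) = length pts"
  by (simp add: evaluate_def)

lemma nth_evaluate [simp]: "i < length pts \<Longrightarrow> evaluate pts f ! i = poly f (pts ! i)"
  by (simp add: evaluate_def)

lemma Poly_vadd: "length x = length y \<Longrightarrow> Poly (vadd x y) = Poly x + Poly y"
  for x :: "'a::comm_semiring_1 list"
  by (rule poly_eqI) (auto simp: nth_default_def)

lemma Poly_eq_iff: "length x = length y \<Longrightarrow> Poly x = Poly y \<longleftrightarrow> x = y"
  for x :: "'a::comm_semiring_1 list"
  by (auto simp: poly_eq_iff nth_default_def list_eq_iff_nth_eq)

lemma Poly_map_coeff:
  fixes f :: "'a::comm_semiring_1 poly"
  assumes "degree f < n"
  shows "Poly (map (coeff f) [0..<n]) = f"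
  using assms by (intro poly_eqI) (auto simp: nth_default_def coeff_eq_0)

lemma degree_Poly_less: "x \<noteq> [] \<Longrightarrow> degree (Poly x) < length x"
proof -
  assume "x \<noteq> []"
  moreover have "degree (Poly x) \<le> length x - 1"
    by (rule degree_le) (auto simp: nth_default_def)
  ultimately show ?thesis by (cases x) auto
qed

lemma roots_count_le_degree:
  fixes f :: "'a::idom poly"
  assumes "distinct pts" "f \<noteq> 0"
  shows "card {i. i < length pts \<and> poly f (pts ! i) = 0} \<le> degree f"
proof -
  have "card {i. i < length pts \<and> poly f (pts ! i) = 0} =
      card ((!) pts ` {i. i < length pts \<and> poly f (pts ! i) = 0})"
    using assms by (intro card_image[symmetric]) (auto intro!: inj_onI simp: nth_eq_iff_index_eq)
  also have "\<dots> \<le> card {x. poly f x = 0}"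
    using assms by (intro card_mono poly_roots_finite) auto
  also have "\<dots> \<le> degree f"
    by (rule card_poly_roots_bound[OF assms(2)])
  finally show ?thesis .
qed

text \<open>Puts the coefficients of exponents \<open>n - h, \<dots>, n - 1\<close> in positions \<open>k, \<dots>, k + h - 1\<close>.\<close>

definition reorder :: "nat \<Rightarrow> nat \<Rightarrow> 'a list \<Rightarrow> 'a list" where
  "reorder k h m = take k m @ drop (k + h) m @ take h (drop k m)"

definition unreorder :: "nat \<Rightarrow> nat \<Rightarrow> 'a list \<Rightarrow> 'a list" where
  "unreorder k h r = take k r @ drop (length r - h) r @ take (length r - h - k) (drop k r)"

lemma length_reorder: "k + h \<le> length m \<Longrightarrow> length (reorder k h m) = length m"
  by (simp add: reorder_def)

lemma length_unreorder: "k + h \<le> length m \<Longrightarrow> length (unreorder k h m) = length m"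
  by (simp add: unreorder_def)

lemma reorder_unreorder:
  assumes "k + h \<le> length r"
  shows "reorder k h (unreorder k h r) = r"
proof -
  have "drop k r = take (length r - h - k) (drop k r) @ drop (length r - h) r"
    using append_take_drop_id[of "length r - h - k" "drop k r"] assms by simp
  then show ?thesis
    using assms by (simp add: reorder_def unreorder_def)
qed

lemma unreorder_reorder:
  assumes "k + h \<le> length m"
  shows "unreorder k h (reorder k h m) = m"
proof -
  have "drop k m = take h (drop k m) @ drop (k + h) m"
    by (metis append_take_drop_id drop_drop add.commute)
  then show ?thesis
    using assms by (simp add: reorder_def unreorder_def)
qed

lemma reorder_vadd:
  assumes "length x = length y"
  shows "reorder k h (vadd x y) = vadd (reorder k h x) (reorder k h y)"
  using assms by (simp add: reorder_def take_vadd drop_vadd zip_append)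

text \<open>Reed-Solomon evaluation. With the zero ancillas at the top exponents, the exponents of
  the superposed ancillas and of the receiver's word are consecutive.\<close>

definition mds_map :: "'a::comm_semiring_1 list \<Rightarrow> nat \<Rightarrow> nat \<Rightarrow> 'a list \<Rightarrow> 'a list" where
  "mds_map pts k h m = evaluate pts (Poly (reorder k h m))"

section \<open>Reed-Solomon weight bounds for the encoding\<close>

context
  fixes pts :: "'a::field list" and n k K h c :: nat
  assumes dist: "distinct pts" and len: "length pts = n"
    and k_eq: "k = K + h" and n_eq: "n = k + h + c" and n_pos: "n > 0"
begin

lemma mds_map_vadd:
  "length x = n \<Longrightarrow> length y = n \<Longrightarrow>
    mds_map pts k h (vadd x y) = vadd (mds_map pts k h x) (mds_map pts k h y)"
  using n_eq len
  by (auto simp: mds_map_def reorder_vadd Poly_vadd length_reorder intro!: nth_equalityI)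

text \<open>The difference of the two polynomials has degree below \<open>n\<close> and vanishes at
  \<open>n\<close> distinct points.\<close>

lemma mds_map_inj:
  assumes "length x = n" "length y = n" "mds_map pts k h x = mds_map pts k h y"
  shows "x = y"
proof -
  let ?f = "Poly (reorder k h x)" and ?g = "Poly (reorder k h y)"
  have l: "length (reorder k h x) = n" "length (reorder k h y) = n"
    using assms n_eq by (auto simp: length_reorder)
  have "degree ?f < n" "degree ?g < n"
    using degree_Poly_less[of "reorder k h x"] degree_Poly_less[of "reorder k h y"] l n_pos
    by fastforce+
  then have deg: "degree (?f - ?g) < n" using degree_diff_less by blast
  have "poly ?f (pts ! i) = poly ?g (pts ! i)" if "i < n" for i
    using assms(3) that len unfolding mds_map_def by (metis nth_evaluate)
  then have "{i. i < length pts \<and> poly (?f - ?g) (pts ! i) = 0} = {..<n}"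
    using len by auto
  then have "?f - ?g = 0"
    using roots_count_le_degree[OF dist, of "?f - ?g"] deg by force
  then have "reorder k h x = reorder k h y" using l by (simp add: Poly_eq_iff)
  then show ?thesis using assms n_eq unreorder_reorder[of k h] by (metis le_add1)
qed

lemma mds_map_of_poly:
  assumes "degree f < n"
  obtains m where "length m = n" "mds_map pts k h m = evaluate pts f"
    "take k m = map (coeff f) [0..<k]"
    "take h (drop k m) = map (coeff f) [n - h..<n]"
    "drop (k + h) m = map (coeff f) [k..<n - h]"
proof -
  let ?r = "map (coeff f) [0..<n]"
  let ?m = "unreorder k h ?r"
  have "length ?m = n" using n_eq by (simp add: length_unreorder)
  moreover have "mds_map pts k h ?m = evaluate pts f"
    using n_eq assms by (simp add: mds_map_def reorder_unreorder Poly_map_coeff)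
  moreover have "take k ?m = map (coeff f) [0..<k]"
    using n_eq by (simp add: unreorder_def take_map)
  moreover have "take h (drop k ?m) = map (coeff f) [n - h..<n]"
    using n_eq by (simp add: unreorder_def drop_map)
  moreover have "drop (k + h) ?m = map (coeff f) [k..<n - h]"
    using n_eq by (simp add: unreorder_def drop_map take_map)
  ultimately show thesis by (rule that)
qed

text \<open>The polynomial has degree below \<open>k\<close>, while weight at most
  \<open>n - k\<close> means at least \<open>k\<close> zeros.\<close>

lemma mds_map_low_weight_eq_zero:
  assumes "length m = n" "drop k m = replicate (n - k) 0" "k > 0"
    and "card {i. i < n \<and> mds_map pts k h m ! i \<noteq> 0} \<le> n - k"
  shows "m = replicate n 0"
proof -
  let ?f = "Poly (reorder k h m)"
  have "drop (k + h) m = replicate c 0"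
    using assms(2) n_eq
    by (metis add.commute drop_drop drop_replicate add_diff_cancel_left' diff_diff_left)
  moreover have "take h (drop k m) = replicate h 0"
    using assms(2) n_eq by simp
  ultimately have "?f = Poly (take k m)"
    by (simp add: reorder_def replicate_add[symmetric])
  then have deg: "degree ?f < k"
    using degree_Poly_less[of "take k m"] assms n_eq by fastforce
  have "card {i. i < n \<and> poly ?f (pts ! i) = 0} + card {i. i < n \<and> poly ?f (pts ! i) \<noteq> 0} =
      card ({i. i < n \<and> poly ?f (pts ! i) = 0} \<union> {i. i < n \<and> poly ?f (pts ! i) \<noteq> 0})"
    by (rule card_Un_disjoint[symmetric]) auto
  also have "{i. i < n \<and> poly ?f (pts ! i) = 0} \<union> {i. i < n \<and> poly ?f (pts ! i) \<noteq> 0} = {..<n}"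
    by auto
  finally have "card {i. i < n \<and> poly ?f (pts ! i) = 0} + card {i. i < n \<and> poly ?f (pts ! i) \<noteq> 0} = n"
    by simp
  moreover have "{i. i < n \<and> mds_map pts k h m ! i \<noteq> 0} = {i. i < n \<and> poly ?f (pts ! i) \<noteq> 0}"
    using len by (auto simp: mds_map_def)
  ultimately have "card {i. i < n \<and> poly ?f (pts ! i) = 0} \<ge> k"
    using assms(4) n_eq by simp
  then have "?f = 0"
    using roots_count_le_degree[OF dist, of ?f] deg len by fastforce
  then have "mds_map pts k h m = replicate n 0"
    using len by (auto simp: mds_map_def intro!: nth_equalityI)
  moreover have "reorder k h (replicate n (0::'a)) = replicate n 0"
    using n_eq by (simp add: reorder_def replicate_add[symmetric])
  then have "mds_map pts k h (replicate n 0) = replicate n 0"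
    using len by (auto simp: mds_map_def intro!: nth_equalityI)
  ultimately show ?thesis using mds_map_inj[of m "replicate n 0"] assms by simp
qed

text \<open>A polynomial vanishing on the support of \<open>b\<close> except at one position reduces
  the dot product to one term, which scaling turns into \<open>t\<close>. A factor
  \<open>X ^ K\<close> clears the information part and does not vanish at nonzero points.\<close>

lemma mds_map_dual_low_weight:
  assumes nonzero: "0 \<notin> set pts"
    and b: "length b = n" "b \<noteq> replicate n 0" "card {i. i < n \<and> b ! i \<noteq> 0} \<le> n - k"
  shows "\<exists>m. length m = n \<and> take K m = replicate K 0 \<and>
    take h (drop k m) = replicate h 0 \<and> dot b (mds_map pts k h m) = t"
proof -
  let ?S = "{i. i < n \<and> b ! i \<noteq> 0}"
  obtain j where j: "j \<in> ?S" using b by (auto simp: list_eq_iff_nth_eq)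
  define f0 where "f0 = monom 1 K * (\<Prod>i\<in>?S - {j}. [:- pts ! i, 1:])"
  have "poly f0 (pts ! i) = 0" if "i \<in> ?S - {j}" for i
    using that by (auto simp: f0_def poly_prod)
  then have f0_0: "poly f0 (pts ! i) = 0" if "i < n" "b ! i \<noteq> 0" "i \<noteq> j" for i
    using that by simp
  have "pts ! j \<noteq> 0" using j len nonzero by (metis (no_types, lifting) mem_Collect_eq nth_mem)
  moreover have "pts ! j \<noteq> pts ! i" if "i \<in> ?S - {j}" for i
    using that j len dist by (auto simp: nth_eq_iff_index_eq)
  ultimately have f0_j: "poly f0 (pts ! j) \<noteq> 0"
    by (auto simp: f0_def poly_prod poly_monom)
  define s where "s = t / (b ! j * poly f0 (pts ! j))"
  define f where "f = smult s f0"
  have "card (?S - {j}) < card ?S"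
    using j by (intro card_Diff1_less) auto
  then have "card (?S - {j}) < n - k" using b(3) by linarith
  moreover have "degree f0 \<le> K + card (?S - {j})"
  proof -
    have "degree f0 \<le> K + degree (\<Prod>i\<in>?S - {j}. [:- pts ! i, 1:])"
      unfolding f0_def by (rule order_trans[OF degree_mult_le]) (simp add: degree_monom_eq)
    also have "degree (\<Prod>i\<in>?S - {j}. [:- pts ! i, 1:]) \<le> card (?S - {j})"
      by (rule order_trans[OF degree_prod_sum_le]) auto
    finally show ?thesis by simp
  qed
  \<comment> \<open>At most \<open>n - k - 1\<close> linear factors and \<open>X ^ K\<close> give
    degree at most \<open>n - h - 1\<close>, so the top \<open>h\<close> coefficients, stored in the
    zero ancillas, vanish.\<close>
  ultimately have deg: "degree f < n - h"
    using k_eq n_eq degree_smult_le[of s f0] unfolding f_def by linarith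
  then have "degree f < n" by simp
  from mds_map_of_poly[OF this] obtain m where m: "length m = n" "mds_map pts k h m = evaluate pts f"
    "take k m = map (coeff f) [0..<k]"
    "take h (drop k m) = map (coeff f) [n - h..<n]" .
  have "take K m = take K (take k m)" using k_eq by simp
  also have "\<dots> = map (coeff f) [0..<K]"
    using k_eq m by (simp add: take_map)
  also have "\<dots> = replicate K 0"
    by (rule nth_equalityI) (auto simp: f_def f0_def coeff_monom_mult)
  finally have "take K m = replicate K 0" .
  moreover have "take h (drop k m) = replicate h 0"
    using m(4) deg n_eq by (auto simp: coeff_eq_0 intro!: nth_equalityI)
  moreover have "dot b (mds_map pts k h m) = t"
  proof -
    have "dot b (mds_map pts k h m) = (\<Sum>i<n. b ! i * (s * poly f0 (pts ! i)))"
      using m b len by (simp add: dot_eq_sum[of _ n] f_def)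
    also have "\<dots> = (\<Sum>i<n. if i = j then t else 0)"
      using f0_0 f0_j j by (intro sum.cong) (auto simp: s_def)
    finally show ?thesis using j by simp
  qed
  ultimately show ?thesis using m by blast
qed

text \<open>The polynomial of degree \<open>k - 1\<close> whose roots are the first
  \<open>k - 1\<close> points attains the weight bound.\<close>

lemma mds_map_min_weight:
  assumes nonzero: "0 \<notin> set pts" and "k > 0"
  obtains m where "length m = n" "drop k m = replicate (n - k) 0"
    "card {i. i < n \<and> mds_map pts k h m ! i \<noteq> 0} = n - k + 1"
    "K > 0 \<Longrightarrow> take K m \<noteq> replicate K 0"
proof -
  define f where "f = (\<Prod>i<k - 1. [:- pts ! i, 1:])"
  have "degree f \<le> k - 1"
    unfolding f_def by (rule order_trans[OF degree_prod_sum_le]) auto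
  then have deg: "degree f < k" using assms by simp
  then have "degree f < n" using n_eq by simp
  from mds_map_of_poly[OF this] obtain m where m: "length m = n" "mds_map pts k h m = evaluate pts f"
    "take k m = map (coeff f) [0..<k]"
    "take h (drop k m) = map (coeff f) [n - h..<n]"
    "drop (k + h) m = map (coeff f) [k..<n - h]" .
  have "drop k m = take h (drop k m) @ drop (k + h) m"
    by (metis append_take_drop_id drop_drop add.commute)
  also have "\<dots> = replicate h 0 @ replicate c 0"
    unfolding m(4,5) using deg n_eq
    by (intro arg_cong2[of _ _ _ _ "(@)"] nth_equalityI) (auto simp: coeff_eq_0)
  finally have dr: "drop k m = replicate (n - k) 0"
    using n_eq by (simp add: replicate_add)
  have "{i. i < n \<and> mds_map pts k h m ! i \<noteq> 0} = {k - 1..<n}"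
    using m len n_eq dist
    by (auto simp: f_def poly_prod nth_eq_iff_index_eq) 
  then have card: "card {i. i < n \<and> mds_map pts k h m ! i \<noteq> 0} = n - k + 1"
    using n_eq assms by simp
  have "take K m \<noteq> replicate K 0" if "K > 0"
  proof -
    \<comment> \<open>For \<open>K > 0\<close> the constant coefficient is an information entry; it
      is a product of negated nonzero points.\<close>
    have "coeff f 0 = (\<Prod>i<k - 1. - pts ! i)"
      by (simp add: f_def poly_prod flip: poly_0_coeff_0)
    also have "\<dots> \<noteq> 0"
    proof -
      have "pts ! i \<in> set pts" if "i < k - 1" for i
        using that len n_eq by (intro nth_mem) simp
      then have "pts ! i \<noteq> 0" if "i < k - 1" for i
        using that nonzero by metis
      then show ?thesis by simp
    qed
    finally have "take k m ! 0 \<noteq> 0" unfolding m(3) using that k_eq by simp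
    then have "take K m ! 0 \<noteq> 0" using that k_eq by simp
    then show ?thesis using that by (metis nth_replicate)
  qed
  then show thesis by (rule that[OF m(1) dr card])
qed

end

section \<open>Existence of the codes and the parameter bounds\<close>

lemma mds_eaqecc_exists:
  fixes p e n K h c :: nat and \<gamma> :: complex
  assumes "prime p" "CARD('a::{field,finite}) = p ^ e" "primitive_root_of_unity p \<gamma>"
    and n: "n = K + h + h + c" and "K + h > 0" "n < CARD('a)"
  shows "\<exists>Q :: 'a state set. mds_eaqecc p e \<gamma> n K (n - (K + h) + 1) c Q"
proof -
  interpret finite_field_char p e \<gamma> "TYPE('a)"
    by unfold_locales (fact assms)+
  \<comment> \<open>The bound on \<open>n\<close> leaves enough nonzero field elements to serve as
    evaluation points.\<close>
  have "card (- {0::'a}) \<ge> n"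
    using assms by (simp add: Compl_eq_Diff_UNIV)
  then obtain A :: "'a set" where A: "A \<subseteq> - {0}" "card A = n"
    by (metis obtain_subset_with_card_n)
  obtain pts where pts: "set pts = A" "distinct pts"
    using finite_distinct_list[of A] by auto
  then have len: "length pts = n" and nz: "0 \<notin> set pts"
    using A distinct_card by force+
  define k where "k = K + h"
  have n_eq: "n = k + h + c" and "k > 0" "n > 0" using assms by (auto simp: k_def)
  note ctx = pts(2) len k_def n_eq \<open>n > 0\<close>
  let ?G = "mds_map pts k h"
  have "inj_on ?G (words n)"
    using mds_map_inj[OF ctx] by (auto intro!: inj_onI)
  moreover have "?G ` words n \<subseteq> words n"
    using len by (auto simp: mds_map_def)
  ultimately have "bij_betw ?G (words n) (words n)"
    using endo_inj_surj finite_words by (metis bij_betw_def)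
  then interpret css_encoding p e \<gamma> "TYPE('a)" ?G n k K h c
    by unfold_locales (use k_def n_eq mds_map_vadd[OF ctx] in simp_all)
  obtain m1 where m1: "length m1 = n" "drop k m1 = replicate (n - k) 0"
    "card {i. i < n \<and> ?G m1 ! i \<noteq> 0} = n - k + 1"
    "K > 0 \<Longrightarrow> take K m1 \<noteq> replicate K 0"
    using mds_map_min_weight[OF ctx nz \<open>k > 0\<close>] by blast
  have "min_distance p e \<gamma> n K c (range encode) (n - k + 1)"
    by (rule min_distance_css[OF \<open>k > 0\<close> _ _ m1])
      (use mds_map_low_weight_eq_zero[OF ctx _ _ \<open>k > 0\<close>] mds_map_dual_low_weight[OF ctx nz] in blast)+
  moreover have "\<exists>U. unitary_oper n U \<and> range encode = ea_code_space n K c U"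
    using unitary_encoder code_space_encoder by blast
  moreover have "int n + int c - int K = 2 * (int (n - k + 1) - 1)"
    using n_eq by (simp add: k_def)
  ultimately have "mds_eaqecc p e \<gamma> n K (n - k + 1) c (range encode)"
    using n_eq by (simp add: mds_eaqecc_def eaqecc_def k_def)
  then show ?thesis unfolding k_def by blast
qed

theorem theorem5:
  fixes p e l n k h :: nat and \<gamma> :: complex
  assumes "prime p" and "e \<ge> 1"
    and "CARD('a::{field,finite}) = p ^ e"
    and "primitive_root_of_unity p \<gamma>"
    and "l \<le> e - 1"
    and "n > 0" and "k > 0"
    and "(n dvd (p ^ e - 1) \<and> 1 \<le> k \<and> k \<le> (p ^ l + n - 1) div (p ^ l + 1)) \<or>
         (l \<ge> 1 \<and> n dvd (p ^ l - 1) \<and> 1 \<le> k \<and> k \<le> n div 2)"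
    and "h \<le> k"
  shows "\<exists>Q :: 'a state set. mds_eaqecc p e \<gamma> n (k - h) (n - k + 1) (n - k - h) Q"
proof -
  have p2: "p \<ge> 2" using assms(1) prime_ge_2_nat by blast
  have "n < p ^ e \<and> 2 * k \<le> n"
    using assms(8)
  proof
    assume A: "n dvd (p ^ e - 1) \<and> 1 \<le> k \<and> k \<le> (p ^ l + n - 1) div (p ^ l + 1)"
    have pe: "p ^ e > 1" using one_less_power[of p e] p2 assms(2) by simp
    then have "n \<le> p ^ e - 1" using A by (intro dvd_imp_le) auto
    moreover have "k * (p ^ l + 1) \<le> p ^ l + n - 1"
      using A by (metis div_times_less_eq_dividend le_trans mult_le_mono1)
    \<comment> \<open>Splitting off one summand \<open>p ^ l + 1\<close> on the left cancels
      \<open>p ^ l\<close>; since \<open>p ^ l + 1 \<ge> 2\<close>, this yields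
      \<open>2 * k \<le> n\<close>.\<close>
    then have "(k - 1) * (p ^ l + 1) + 2 \<le> n"
      using A assms(6) by (cases k) auto
    moreover have "(k - 1) * 2 \<le> (k - 1) * (p ^ l + 1)"
      using p2 by (intro mult_le_mono2) simp
    ultimately show ?thesis using pe A by linarith
  next
    assume A: "l \<ge> 1 \<and> n dvd (p ^ l - 1) \<and> 1 \<le> k \<and> k \<le> n div 2"
    \<comment> \<open>\<open>l \<ge> 1\<close> makes \<open>p ^ l - 1\<close> positive, so that
      divisibility bounds \<open>n\<close>.\<close>
    have pl: "p ^ l > 1" using one_less_power[of p l] p2 A by simp
    then have "n \<le> p ^ l - 1" using A by (intro dvd_imp_le) auto
    moreover have "p ^ l \<le> p ^ e" using p2 assms(5) by (intro power_increasing) auto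
    ultimately show ?thesis using pl A by linarith
  qed
  \<comment> \<open>\<open>h \<le> k\<close> and \<open>2 * k \<le> n\<close> keep the subtractions
    \<open>k - h\<close> and \<open>n - k - h\<close> from truncating.\<close>
  then have "n = (k - h) + h + h + (n - k - h)" "(k - h) + h > 0" "n < CARD('a)"
    and "(k - h) + h = k"
    using assms by auto
  then show ?thesis
    using mds_eaqecc_exists[where ?'a='a, OF assms(1,3,4), of n "k - h" h "n - k - h"] by metis
qed

end
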